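(* Let $\Gamma$ be a weighted graph with vertex set $V$. Assume $\Gamma$ is connected and satisfies the Sunada-Sy condition. Let $H$ be a Schrödinger operator on $\Gamma$. If $\Omega\subset V$ admits a one-by-one exhaustion, then $H$ satisfies $\lambda$-uniqueness on $\Omega$ for any $\lambda\in\mathbb{R}$.
   Context: Graph (Serre): $\Gamma=(V,E,o,t,\iota)$ with vertex set $V$, set $E$ of oriented edges, origin and terminus maps $o,t:E\to V$, and a fixed point free involution $\iota(e)=\overline{e}$ of $E$ with $o(\overline e)=t(e)$, $t(\overline e)=o(e)$. Loops and multiple edges are allowed; local finiteness is not assumed. $E_x=\{e\in E:o(e)=x\}$. $\Gamma$ is connected if any two vertices are joined by a finite edge path; the path-metric $d(x,y)$ is the minimal length of a path from $x$ to $y$. $B(x,r)=\{y\in V:d(x,y)\le r\}$. Weighted graph: strictly positive weights $m_V:V\to\,]0,\infty[$ and $m_E:E\to\,]0,\infty[$ with $m_E(\overline e)=m_E(e)$. $l^2(V,m_V)$ is the Hilbert space of $\varphi:V\to\mathbb{C}$ with $\sum_x|\varphi(x)|^2m_V(x)<\infty$, with product $\langle\varphi,\psi\rangle=\sum_x\varphi(x)\overline{\psi(x)}m_V(x)$. Sunada-Sy condition: $\sup_{x\in V}\frac{1}{m_V(x)}\sum_{e\in E_x}m_E(e)<\infty$. Laplacian: the bounded operator on $l^2(V,m_V)$ given by $\Delta\varphi(x)=\left(\frac{1}{m_V(x)}\sum_{e\in E_x}m_E(e)\right)\varphi(x)-\frac{1}{m_V(x)}\sum_{e\in E_x}\varphi(t(e))m_E(e)$.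 Schrödinger operator: $H=\Delta+q$ with $q:V\to\mathbb{R}$ bounded, i.e. $H\varphi(x)=\Delta\varphi(x)+q(x)\varphi(x)$. $\lambda$-uniqueness on $\Omega\subset V$: if $\varphi\in l^2(V,m_V)$ satisfies $H\varphi=\lambda\varphi$ and $\varphi(x)=0$ for all $x\in V\setminus\Omega$, then $\varphi=0$ on $V$. One-by-one exhaustion of $\Omega\subset V$: a countable (finite or infinite) non-decreasing sequence $V_0\subset\cdots\subset V_n\subset V_{n+1}\subset\cdots$ of subsets of $V$ such that (1) $V_0=V\setminus\Omega$; (2) for each $n$ (for which $V_{n+1}$ is a term of the sequence) there exists $x_n\in V_n$ with $V_{n+1}=V_n\cup B(x_n,1)$; (3) for each such $n$, either $|V_{n+1}\setminus V_n|=1$ or $V_n=V$; (4) $\bigcup_nV_n=V$. *)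

theory Defs
  imports
    "HOL-Analysis.Analysis"
    "HOL-Library.Extended_Nat"
    "Graph_Theory.Arc_Walk"
    "Graph_Theory.Bidirected_Digraph"
begin

text \<open>
  A graph in the sense of Serre is a \<^locale>\<open>bidirected_digraph\<close>: the set of oriented edges is
  \<^term>\<open>arcs G\<close>, origin and terminus are \<^term>\<open>tail G\<close> and \<^term>\<open>head G\<close>, and the involution is
  \<open>arev\<close>, which has no fixed point on \<^term>\<open>arcs G\<close> (and, by convention of that locale, is
  the identity off \<^term>\<open>arcs G\<close>). Loops, multiple edges and vertices of infinite valency are
  allowed. The set of edges with origin \<open>x\<close> is \<^term>\<open>out_arcs G x\<close>.

  Functions on vertices are total functions on the type \<open>'a\<close>, of which only the
  values on \<^term>\<open>verts G\<close> matter.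
\<close>

locale weighted_graph = bidirected_digraph G arev
  for G :: "('a, 'b) pre_digraph" and arev :: "'b \<Rightarrow> 'b" +
  fixes mV :: "'a \<Rightarrow> real" and mE :: "'b \<Rightarrow> real"
  assumes mV_pos: "x \<in> verts G \<Longrightarrow> 0 < mV x"
    and mE_pos: "e \<in> arcs G \<Longrightarrow> 0 < mE e"
    and mE_arev: "e \<in> arcs G \<Longrightarrow> mE (arev e) = mE e"

definition graph_connected :: "('a, 'b) pre_digraph \<Rightarrow> bool" where
  "graph_connected G \<longleftrightarrow> (\<forall>x\<in>verts G. \<forall>y\<in>verts G. \<exists>p. pre_digraph.awalk G x p y)"

text \<open>The infimum is \<open>\<infinity>\<close> if no edge path joins the two vertices, and a minimum otherwise.\<close>

definition path_dist :: "('a, 'b) pre_digraph \<Rightarrow> 'a \<Rightarrow> 'a \<Rightarrow> enat" where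
  "path_dist G x y = (INF p\<in>{p. pre_digraph.awalk G x p y}. enat (length p))"

definition graph_ball :: "('a, 'b) pre_digraph \<Rightarrow> 'a \<Rightarrow> nat \<Rightarrow> 'a set" where
  "graph_ball G x r = {y \<in> verts G. path_dist G x y \<le> enat r}"

definition l2 :: "('a, 'b) pre_digraph \<Rightarrow> ('a \<Rightarrow> real) \<Rightarrow> ('a \<Rightarrow> complex) set" where
  "l2 G mV = {\<phi>. (\<lambda>x. (cmod (\<phi> x))\<^sup>2 * mV x) summable_on verts G}"

text \<open>
  Summability has to be required separately, as \<^const>\<open>infsum\<close> is \<open>0\<close> on families that are not
  summable.
\<close>

definition sunada_sy ::
    "('a, 'b) pre_digraph \<Rightarrow> ('a \<Rightarrow> real) \<Rightarrow> ('b \<Rightarrow> real) \<Rightarrow> bool" where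
  "sunada_sy G mV mE \<longleftrightarrow>
     (\<forall>x\<in>verts G. mE summable_on out_arcs G x) \<and>
     bdd_above ((\<lambda>x. 1 / mV x * (\<Sum>\<^sub>\<infinity>e\<in>out_arcs G x. mE e)) ` verts G)"

text \<open>
  Under the Sunada-Sy condition both sums converge absolutely for \<open>\<phi>\<close> in \<^const>\<open>l2\<close>; see
  \<open>laplacian_summable\<close> below for the second one.
\<close>

definition laplacian ::
    "('a, 'b) pre_digraph \<Rightarrow> ('a \<Rightarrow> real) \<Rightarrow> ('b \<Rightarrow> real) \<Rightarrow> ('a \<Rightarrow> complex) \<Rightarrow> 'a \<Rightarrow> complex" where
  "laplacian G mV mE \<phi> x =
     of_real (1 / mV x * (\<Sum>\<^sub>\<infinity>e\<in>out_arcs G x. mE e)) * \<phi> x -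
     of_real (1 / mV x) * (\<Sum>\<^sub>\<infinity>e\<in>out_arcs G x. \<phi> (head G e) * of_real (mE e))"

definition schrodinger ::
    "('a, 'b) pre_digraph \<Rightarrow> ('a \<Rightarrow> real) \<Rightarrow> ('b \<Rightarrow> real) \<Rightarrow> ('a \<Rightarrow> real) \<Rightarrow>
     ('a \<Rightarrow> complex) \<Rightarrow> 'a \<Rightarrow> complex" where
  "schrodinger G mV mE q \<phi> x = laplacian G mV mE \<phi> x + of_real (q x) * \<phi> x"

definition eigen_uniqueness ::
    "('a, 'b) pre_digraph \<Rightarrow> ('a \<Rightarrow> real) \<Rightarrow> (('a \<Rightarrow> complex) \<Rightarrow> 'a \<Rightarrow> complex) \<Rightarrow> real \<Rightarrow> 'a set \<Rightarrow> bool" where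
  "eigen_uniqueness G mV H lam \<Omega> \<longleftrightarrow>
     (\<forall>\<phi>\<in>l2 G mV.
        (\<forall>x\<in>verts G. H \<phi> x = of_real lam * \<phi> x) \<longrightarrow>
        (\<forall>x\<in>verts G - \<Omega>. \<phi> x = 0) \<longrightarrow>
        (\<forall>x\<in>verts G. \<phi> x = 0))"

text \<open>
  \<open>N\<close> is the last index of the sequence, with \<open>N = \<infinity>\<close> for an infinite sequence; values
  \<open>W n\<close> with \<open>n > N\<close> are not terms of the sequence and are unconstrained.
\<close>

definition one_by_one_exhaustion ::
    "('a, 'b) pre_digraph \<Rightarrow> 'a set \<Rightarrow> enat \<Rightarrow> (nat \<Rightarrow> 'a set) \<Rightarrow> bool" where
  "one_by_one_exhaustion G \<Omega> N W \<longleftrightarrow>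
     (\<forall>n. enat n \<le> N \<longrightarrow> W n \<subseteq> verts G) \<and>
     (\<forall>n. enat (Suc n) \<le> N \<longrightarrow> W n \<subseteq> W (Suc n)) \<and>
     W 0 = verts G - \<Omega> \<and>
     (\<forall>n. enat (Suc n) \<le> N \<longrightarrow> (\<exists>x\<in>W n. W (Suc n) = W n \<union> graph_ball G x 1)) \<and>
     (\<forall>n. enat (Suc n) \<le> N \<longrightarrow> card (W (Suc n) - W n) = 1 \<or> W n = verts G) \<and>
     (\<Union>n\<in>{n. enat n \<le> N}. W n) = verts G"

definition admits_one_by_one_exhaustion :: "('a, 'b) pre_digraph \<Rightarrow> 'a set \<Rightarrow> bool" where
  "admits_one_by_one_exhaustion G \<Omega> \<longleftrightarrow> (\<exists>N W. one_by_one_exhaustion G \<Omega> N W)"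

lemma (in weighted_graph) laplacian_summable:
  assumes ss: "sunada_sy G mV mE" and \<phi>: "\<phi> \<in> l2 G mV" and x: "x \<in> verts G"
  shows "(\<lambda>e. norm (\<phi> (head G e) * of_real (mE e))) summable_on out_arcs G x"
proof -
  obtain C where C: "\<And>y. y \<in> verts G \<Longrightarrow> 1 / mV y * (\<Sum>\<^sub>\<infinity>e\<in>out_arcs G y. mE e) \<le> C"
    using ss unfolding sunada_sy_def bdd_above_def by blast
  have mE_nn: "0 \<le> mE e" if "e \<in> arcs G" for e using mE_pos[OF that] by simp
  have mV_nn: "0 \<le> mV y" if "y \<in> verts G" for y using mV_pos[OF that] by simp
  have sumE: "\<And>y. y \<in> verts G \<Longrightarrow> mE summable_on out_arcs G y"
    using ss unfolding sunada_sy_def by auto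
  have C': "(\<Sum>\<^sub>\<infinity>e\<in>out_arcs G y. mE e) \<le> C * mV y" if "y \<in> verts G" for y
    using C[OF that] mV_pos[OF that] by (simp add: field_simps)
  have sumL: "(\<lambda>y. (cmod (\<phi> y))\<^sup>2 * mV y) summable_on verts G"
    using \<phi> unfolding l2_def by auto
  have Cnn: "0 \<le> C"
  proof -
    have "0 \<le> (\<Sum>\<^sub>\<infinity>e\<in>out_arcs G x. mE e)"
      by (rule infsum_nonneg) (simp add: mE_nn)
    then have "0 \<le> C * mV x" using C'[OF x] by linarith
    then show ?thesis using mV_pos[OF x] by (simp add: zero_le_mult_iff)
  qed
  define M where "M = C * (\<Sum>\<^sub>\<infinity>y\<in>verts G. (cmod (\<phi> y))\<^sup>2 * mV y)"
  have bound: "(\<Sum>e\<in>F. (cmod (\<phi> (head G e)))\<^sup>2 * mE e) \<le> M"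
    if F: "finite F" "F \<subseteq> out_arcs G x" for F
  proof -
    have Fa: "F \<subseteq> arcs G" using F by auto
    have hV: "head G ` F \<subseteq> verts G" using Fa by auto
    have inner: "sum mE {e\<in>F. head G e = y} \<le> C * mV y" if y: "y \<in> verts G" for y
    proof -
      let ?S = "{e\<in>F. head G e = y}"
      have "sum mE ?S = sum (mE \<circ> arev) ?S"
        by (rule sum.cong) (use Fa mE_arev in auto)
      also have "\<dots> = sum mE (arev ` ?S)" by (simp add: sum.reindex inj_on_arev)
      also have "\<dots> \<le> (\<Sum>\<^sub>\<infinity>e\<in>out_arcs G y. mE e)"
        by (rule finite_sum_le_infsum)
          (use F Fa sumE[OF y] mE_nn in auto)
      finally show ?thesis using C'[OF y] by linarith
    qed
    have "(\<Sum>e\<in>F. (cmod (\<phi> (head G e)))\<^sup>2 * mE e)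
        = (\<Sum>y\<in>head G ` F. \<Sum>e\<in>{e\<in>F. head G e = y}. (cmod (\<phi> (head G e)))\<^sup>2 * mE e)"
      by (rule sum.image_gen[OF F(1)])
    also have "\<dots> = (\<Sum>y\<in>head G ` F. (cmod (\<phi> y))\<^sup>2 * sum mE {e\<in>F. head G e = y})"
      by (simp add: sum_distrib_left)
    also have "\<dots> \<le> (\<Sum>y\<in>head G ` F. (cmod (\<phi> y))\<^sup>2 * (C * mV y))"
      by (rule sum_mono) (use inner hV in \<open>auto intro!: mult_left_mono\<close>)
    also have "\<dots> = C * (\<Sum>y\<in>head G ` F. (cmod (\<phi> y))\<^sup>2 * mV y)"
      by (simp add: sum_distrib_left mult_ac)
    also have "\<dots> \<le> M" unfolding M_def
      by (intro mult_left_mono finite_sum_le_infsum)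
        (use F hV sumL Cnn mV_nn in auto)
    finally show ?thesis .
  qed
  have s1: "(\<lambda>e. (cmod (\<phi> (head G e)))\<^sup>2 * mE e) summable_on out_arcs G x"
    by (rule nonneg_bdd_above_summable_on)
      (use bound mE_nn in \<open>auto intro!: bdd_aboveI[of _ M]\<close>)
  have s2: "(\<lambda>e. (cmod (\<phi> (head G e)))\<^sup>2 * mE e + mE e) summable_on out_arcs G x"
    using s1 sumE[OF x] by (rule summable_on_add)
  show ?thesis
  proof (rule summable_on_comparison_test[OF s2])
    fix e assume e: "e \<in> out_arcs G x"
    then have p: "0 < mE e" using mE_pos by auto
    let ?a = "cmod (\<phi> (head G e))"
    have "?a \<le> ?a\<^sup>2 + 1"
      using sum_squares_bound[of ?a 1] norm_ge_zero[of "\<phi> (head G e)"]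
      unfolding mult_1_right power_one by linarith
    then have "?a * mE e \<le> (?a\<^sup>2 + 1) * mE e" using p by (intro mult_right_mono) auto
    then show "norm (\<phi> (head G e) * of_real (mE e)) \<le> ?a\<^sup>2 * mE e + mE e"
      using p by (simp add: norm_mult algebra_simps)
  qed auto
qed

end

theory Submission
  imports Defs
begin

text \<open>
  Let \<open>\<phi>\<close> be an eigenfunction vanishing off \<open>\<Omega>\<close>. Where \<open>\<phi> x = 0\<close>, the potential, the eigenvalue
  and the diagonal part of the Laplacian all drop out of the eigenvalue equation at \<open>x\<close>, which
  becomes the statement that the weighted sum of \<open>\<phi>\<close> over the edges leaving \<open>x\<close> is zero
  (\<open>schrodinger_eigen_at_zero\<close>). If in addition \<open>\<phi>\<close> is known to vanish at every
  neighbour of \<open>x\<close> except one, say \<open>y\<close>, this sum is \<open>\<phi> y\<close> times the total weight of the edges from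
  \<open>x\<close> to \<open>y\<close>. That weight is positive, so \<open>\<phi> y = 0\<close> (\<open>zero_at_single_new_neighbour\<close>).

  A one-by-one exhaustion supplies such an \<open>x\<close> for each vertex in turn, so by induction \<open>\<phi>\<close> vanishes
  on every term of the sequence, hence on all of \<^term>\<open>verts G\<close>.
\<close>

context weighted_graph
begin

lemma head_in_graph_ball:
  assumes e: "e \<in> out_arcs G x"
  shows "head G e \<in> graph_ball G x 1"
proof -
  have "awalk x [e] (head G e)" using e by (auto simp: awalk_simps)
  then have "path_dist G x (head G e) \<le> enat (length [e])"
    unfolding path_dist_def by (intro INF_lower) simp
  then show ?thesis using e by (auto simp: graph_ball_def)
qed

lemma graph_ball_1_cases:
  assumes y: "y \<in> graph_ball G x 1"
  obtains "y = x" | e where "e \<in> out_arcs G x" "head G e = y"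
proof -
  have "path_dist G x y < enat 2"
    using y by (auto simp: graph_ball_def intro: le_less_trans)
  then obtain p where p: "awalk x p y" and "length p < 2"
    unfolding path_dist_def INF_less_iff by auto
  then consider "p = []" | e where "p = [e]"
    by (cases p) (auto simp: less_Suc_eq numeral_2_eq_2)
  then show thesis
    by cases (use p that in \<open>auto simp: awalk_simps\<close>)
qed

lemma schrodinger_eigen_at_zero:
  assumes x: "x \<in> verts G" and eig: "schrodinger G mV mE q \<phi> x = c * \<phi> x" and zero: "\<phi> x = 0"
  shows "(\<Sum>\<^sub>\<infinity>e\<in>out_arcs G x. \<phi> (head G e) * of_real (mE e)) = 0"
  using eig zero mV_pos[OF x] by (simp add: schrodinger_def laplacian_def)

lemma zero_at_single_new_neighbour:
  assumes x: "x \<in> verts G" and sumE: "mE summable_on out_arcs G x"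
    and sum0: "(\<Sum>\<^sub>\<infinity>e\<in>out_arcs G x. \<phi> (head G e) * of_real (mE e)) = (0 :: complex)"
    and others: "\<And>e. e \<in> out_arcs G x \<Longrightarrow> head G e \<noteq> y \<Longrightarrow> \<phi> (head G e) = 0"
    and e: "e \<in> out_arcs G x" "head G e = y"
  shows "\<phi> y = 0"
proof -
  let ?S = "{e \<in> out_arcs G x. head G e = y}"
  have sumS: "mE summable_on ?S" by (rule summable_on_subset_banach[OF sumE]) auto
  have "(\<Sum>\<^sub>\<infinity>e\<in>out_arcs G x. \<phi> (head G e) * of_real (mE e)) = (\<Sum>\<^sub>\<infinity>e\<in>?S. \<phi> y * of_real (mE e))"
    by (rule infsum_cong_neutral) (use others in auto)
  also have "\<dots> = \<phi> y * of_real (\<Sum>\<^sub>\<infinity>e\<in>?S. mE e)"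
    using infsumI[OF has_sum_of_real[OF has_sum_infsum[OF sumS], where 'a = complex]]
    by (simp add: infsum_cmult_right')
  finally have prod0: "\<phi> y * of_real (\<Sum>\<^sub>\<infinity>e\<in>?S. mE e) = 0" using sum0 by simp
  have "0 < mE e" using e mE_pos by auto
  also have "mE e \<le> (\<Sum>\<^sub>\<infinity>e\<in>?S. mE e)"
  proof -
    have "sum mE {e} \<le> (\<Sum>\<^sub>\<infinity>e\<in>?S. mE e)"
      by (rule finite_sum_le_infsum[OF sumS]) (use e mE_pos in \<open>auto intro: less_imp_le\<close>)
    then show ?thesis by simp
  qed
  finally show ?thesis using prod0 by simp
qed

text \<open>
  Only a step that adds exactly one vertex \<open>y\<close> needs an argument. As \<open>y\<close> comes from the ball around
  a vertex \<open>x\<close> already in the set, it is joined to \<open>x\<close> by an edge, and any other neighbour of \<open>x\<close>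
  lies in the ball without being new.
\<close>

lemma eigenfunction_zero_on_exhaustion:
  assumes exh: "one_by_one_exhaustion G \<Omega> N W"
    and sumE: "\<And>x. x \<in> verts G \<Longrightarrow> mE summable_on out_arcs G x"
    and eig: "\<And>x. x \<in> verts G \<Longrightarrow> schrodinger G mV mE q \<phi> x = c * \<phi> x"
    and zero: "\<And>x. x \<in> verts G - \<Omega> \<Longrightarrow> \<phi> x = 0"
  shows "enat n \<le> N \<Longrightarrow> z \<in> W n \<Longrightarrow> \<phi> z = 0"
proof (induction n arbitrary: z)
  case 0
  then show ?case using exh zero by (auto simp: one_by_one_exhaustion_def)
next
  case (Suc n)
  have nN: "enat n \<le> N" using Suc.prems(1) by (meson enat_ord_simps(1) lessI less_imp_le order_trans)
  have sub: "W n \<subseteq> verts G" "W (Suc n) \<subseteq> verts G"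
    using exh nN Suc.prems(1) by (auto simp: one_by_one_exhaustion_def)
  obtain x where x: "x \<in> W n" and W: "W (Suc n) = W n \<union> graph_ball G x 1"
    using exh Suc.prems(1) by (auto simp: one_by_one_exhaustion_def)
  have "card (W (Suc n) - W n) = 1 \<or> W n = verts G"
    using exh Suc.prems(1) by (auto simp: one_by_one_exhaustion_def)
  then show ?case
  proof
    assume "W n = verts G"
    then show ?thesis using Suc.IH nN Suc.prems(2) sub by blast
  next
    assume "card (W (Suc n) - W n) = 1"
    then obtain y where y: "W (Suc n) - W n = {y}" by (auto simp: card_1_singleton_iff)
    then have "y \<in> graph_ball G x 1" and "y \<noteq> x" using W x by auto
    then obtain e where e: "e \<in> out_arcs G x" "head G e = y" by (metis graph_ball_1_cases)
    have "\<phi> y = 0"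
    proof (rule zero_at_single_new_neighbour[OF _ _ _ _ e])
      show xV: "x \<in> verts G" using x sub by auto
      show "mE summable_on out_arcs G x" by (rule sumE[OF xV])
      show "(\<Sum>\<^sub>\<infinity>e\<in>out_arcs G x. \<phi> (head G e) * of_real (mE e)) = 0"
        by (rule schrodinger_eigen_at_zero[OF xV eig[OF xV] Suc.IH[OF nN x]])
      fix e' assume "e' \<in> out_arcs G x" "head G e' \<noteq> y"
      then have "head G e' \<in> W n" using head_in_graph_ball[of e' x] W y by auto
      then show "\<phi> (head G e') = 0" by (rule Suc.IH[OF nN])
    qed
    moreover have "z \<in> W n \<or> z = y" using Suc.prems(2) y by blast
    ultimately show ?thesis using Suc.IH[OF nN] by blast
  qed
qed

end

theorem theorem3p6:
  fixes G :: "('a, 'b) pre_digraph" and arev :: "'b \<Rightarrow> 'b"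
    and mV :: "'a \<Rightarrow> real" and mE :: "'b \<Rightarrow> real" and q :: "'a \<Rightarrow> real"
    and \<Omega> :: "'a set" and lam :: real
  assumes "weighted_graph G arev mV mE"
    and "graph_connected G"
    and "sunada_sy G mV mE"
    and "bounded (q ` verts G)"
    and "\<Omega> \<subseteq> verts G"
    and "admits_one_by_one_exhaustion G \<Omega>"
  shows "eigen_uniqueness G mV (schrodinger G mV mE q) lam \<Omega>"
  unfolding eigen_uniqueness_def
proof (intro ballI impI)
  interpret weighted_graph G arev mV mE by (rule assms(1))
  fix \<phi> z
  assume eig: "\<forall>x\<in>verts G. schrodinger G mV mE q \<phi> x = of_real lam * \<phi> x"
    and zero: "\<forall>x\<in>verts G - \<Omega>. \<phi> x = 0" and z: "z \<in> verts G"
  obtain N W where exh: "one_by_one_exhaustion G \<Omega> N W"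
    using assms(6) by (auto simp: admits_one_by_one_exhaustion_def)
  then have "(\<Union>n\<in>{n. enat n \<le> N}. W n) = verts G"
    unfolding one_by_one_exhaustion_def by blast
  then obtain n where "enat n \<le> N" "z \<in> W n" using z by blast
  then show "\<phi> z = 0"
    using eigenfunction_zero_on_exhaustion[OF exh] eig zero assms(3)
    unfolding sunada_sy_def by blast
qed

end
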